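(* Let $r\ge 1$ be an integer and let $e_1,\ldots,e_r$ denote the standard unit vectors in $\mathbb{R}^r$. (i) There exists a matrix $C_1$ which is an extreme point of $\operatorname{Cor}\big(r,\binom r2+1\big)$ and has rank $r$. One can take $C_1$ to be the matrix with columns $(e_i-e_j)/\sqrt2$ (for $1\le i<j\le r$) and $(e_1+\cdots+e_r)/\sqrt r$. (ii) There exists a matrix $C_2$ which is an extreme point of $\operatorname{Cor}\big(r,\binom r2\big)$ and has rank $r-1$. One can take $C_2$ to be the matrix whose columns are $-\sqrt{\frac{r}{2(r-1)}}\,(e_i-e_j)$ for $1\le i<j\le r$.
   Context: A matrix $C\in\mathbb{R}^{m\times n}$ is called a bipartite correlation matrix if there exist real unit vectors $x_1,\ldots,x_m,y_1,\ldots,y_n\in\mathbb{R}^d$ (for some $d\ge1$) such that $C_{s,t}=\langle x_s,y_t\rangle$ (Euclidean inner product) for all $s\in\{1,\ldots,m\}$ and $t\in\{1,\ldots,n\}$. $\operatorname{Cor}(m,n)\subseteq\mathbb{R}^{m\times n}$ denotes the (convex) set of all $m\times n$ bipartite correlation matrices. *)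

theory Defs
  imports Jordan_Normal_Form.DL_Rank
begin

definition unit_vector :: "real vec \<Rightarrow> bool" where
  "unit_vector x \<longleftrightarrow> sqrt (x \<bullet> x) = 1"

text \<open>Rows, columns and vector families are indexed from 0. The dimensions are explicit
  natural numbers, since \<open>m\<close>, \<open>n\<close> and \<open>d\<close> vary and \<open>n\<close> may be 0.\<close>

definition Cor :: "nat \<Rightarrow> nat \<Rightarrow> real mat set" where
  "Cor m n = {C \<in> carrier_mat m n.
     \<exists>d\<ge>1. \<exists>x y.
       (\<forall>s<m. x s \<in> carrier_vec d \<and> unit_vector (x s)) \<and>
       (\<forall>t<n. y t \<in> carrier_vec d \<and> unit_vector (y t)) \<and>
       (\<forall>s<m. \<forall>t<n. C $$ (s, t) = x s \<bullet> y t)}"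

text \<open>The constant \<open>extreme_point_of\<close> of HOL-Analysis needs the class \<open>real_vector\<close>, which
  \<open>real mat\<close> cannot instantiate (addition is only meaningful at equal dimensions).
  This is its unfolding: \<open>C\<close> lies in \<open>S\<close> but in no open segment between two distinct points
  of \<open>S\<close>. It is used for sets \<open>S\<close> of matrices of one common dimension only.\<close>

definition extreme_point_mat :: "real mat \<Rightarrow> real mat set \<Rightarrow> bool" where
  "extreme_point_mat C S \<longleftrightarrow> C \<in> S \<and>
     (\<forall>A\<in>S. \<forall>B\<in>S. \<not> (A \<noteq> B \<and> (\<exists>u>0. u < 1 \<and> C = (1 - u) \<cdot>\<^sub>m A + u \<cdot>\<^sub>m B)))"

text \<open>The pairs \<open>i < j < r\<close> in lexicographic order; they fix the order of the columns.\<close>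

definition index_pairs :: "nat \<Rightarrow> (nat \<times> nat) list" where
  "index_pairs r = [(i, j). i \<leftarrow> [0..<r], j \<leftarrow> [Suc i..<r]]"

definition C1_mat :: "nat \<Rightarrow> real mat" where
  "C1_mat r = mat_of_cols r
     ([(1 / sqrt 2) \<cdot>\<^sub>v (unit_vec r i - unit_vec r j). (i, j) \<leftarrow> index_pairs r] @
      [(1 / sqrt (real r)) \<cdot>\<^sub>v finsum_vec TYPE(real) r (unit_vec r) {0..<r}])"

text \<open>For \<open>r = 1\<close> there are no columns, so the division by zero in the scalar is immaterial.\<close>

definition C2_mat :: "nat \<Rightarrow> real mat" where
  "C2_mat r = mat_of_cols r
     [(- sqrt (real r / (2 * (real r - 1)))) \<cdot>\<^sub>v (unit_vec r i - unit_vec r j).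
        (i, j) \<leftarrow> index_pairs r]"

end

theory Submission
  imports Defs
begin

text \<open>
  Both matrices are extreme because they are exposed: each is the unique maximiser of a linear
  functional on the set of correlation matrices. (For \<open>r = 1\<close> the second matrix has no columns, and
  the claim about it is trivial; below \<open>r \<ge> 2\<close> is understood for it.) The functionals come from sums of squares.

  For unit vectors \<open>x\<^sub>s\<close> and \<open>y\<^sub>i\<^sub>j\<close> and a real \<open>\<kappa>\<close>, expand \<open>R = \<Sum>\<^sub>i\<^sub><\<^sub>j \<bar>\<kappa> y\<^sub>i\<^sub>j - (x\<^sub>i - x\<^sub>j)\<bar>\<^sup>2\<close>. Lagrange's
  identity \<open>\<Sum>\<^sub>i\<^sub><\<^sub>j \<bar>x\<^sub>i - x\<^sub>j\<bar>\<^sup>2 = r \<Sum>\<^sub>s \<bar>x\<^sub>s\<bar>\<^sup>2 - \<bar>\<Sum>\<^sub>s x\<^sub>s\<bar>\<^sup>2\<close> removes every inner product between two of the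
  \<open>x\<^sub>s\<close> except those in \<open>\<bar>\<Sum>\<^sub>s x\<^sub>s\<bar>\<^sup>2\<close>. Hence \<open>R + \<bar>\<Sum>\<^sub>s x\<^sub>s\<bar>\<^sup>2\<close> is a constant minus a linear functional of
  the correlation matrix (lemma \<open>pair_residual\<close>). For the second matrix take
  \<open>\<kappa> = - \<surd>(2r / (r - 1))\<close>. For the first, take \<open>\<kappa> = \<surd>2\<close> and add \<open>\<bar>\<surd>r y - \<Sum>\<^sub>s x\<^sub>s\<bar>\<^sup>2\<close>, where \<open>y\<close> belongs
  to the last column, in place of \<open>\<bar>\<Sum>\<^sub>s x\<^sub>s\<bar>\<^sup>2\<close>: the term \<open>\<bar>\<Sum>\<^sub>s x\<^sub>s\<bar>\<^sup>2\<close> cancels. In both cases a sum of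
  squares bounds the functional from above, and the given matrix attains the bound.

  Conversely, if the bound is attained, all squares vanish, so \<open>\<kappa> y\<^sub>i\<^sub>j = x\<^sub>i - x\<^sub>j\<close>. As the \<open>x\<^sub>s\<close>
  and \<open>y\<^sub>i\<^sub>j\<close> have norm one, this fixes \<open>\<langle>x\<^sub>i, x\<^sub>j\<rangle> = 1 - \<kappa>\<^sup>2 / 2\<close>, and with it every entry \<open>\<langle>x\<^sub>s, y\<^sub>i\<^sub>j\<rangle>\<close> (lemma
  \<open>pair_residual_zero_imp_Gram\<close>). The last column of the first matrix
  is then fixed by \<open>\<surd>r y = \<Sum>\<^sub>s x\<^sub>s\<close>. So the maximiser is unique. The optimal \<open>x\<^sub>s\<close> form an orthonormal
  basis for the first matrix and a regular simplex for the second.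

  For the ranks, each matrix \<open>A\<close> is compared with a matrix \<open>B\<close> that has a left inverse and the same
  column space: the identity for the first matrix, and the columns \<open>e\<^sub>j - e\<^sub>r\<close> with \<open>j < r\<close> for the
  second. Lagrange's identity in its bilinear form writes \<open>B\<close> as a product \<open>A E\<close>.
\<close>

section \<open>Sums over the pairs of indices\<close>

lemma sum_list_concat: "sum_list (concat xss) = sum_list (map sum_list xss)"
  for xss :: "'a::monoid_add list list"
  by (induction xss) simp_all

lemma sum_index_pairs:
  "(\<Sum>t<length (index_pairs r). f (index_pairs r ! t)) = (\<Sum>i<r. \<Sum>j\<in>{Suc i..<r}. f (i, j))"
  for f :: "nat \<times> nat \<Rightarrow> 'a::comm_monoid_add"
proof -
  have "(\<Sum>t<length (index_pairs r). f (index_pairs r ! t)) = sum_list (map f (index_pairs r))"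
    by (simp add: sum_list_sum_nth atLeast0LessThan)
  also have "\<dots> = (\<Sum>i<r. \<Sum>j\<in>{Suc i..<r}. f (i, j))"
    by (simp add: index_pairs_def map_concat sum_list_concat comp_def
        interv_sum_list_conv_sum_set_nat atLeast0LessThan)
  finally show ?thesis .
qed

lemma sum_less_pairs_Suc:
  "(\<Sum>i<Suc r. \<Sum>j\<in>{Suc i..<Suc r}. g i j) = (\<Sum>i<r. \<Sum>j\<in>{Suc i..<r}. g i j) + (\<Sum>i<r. g i r)"
  for g :: "nat \<Rightarrow> nat \<Rightarrow> 'a::comm_monoid_add"
proof -
  have "(\<Sum>i<Suc r. \<Sum>j\<in>{Suc i..<Suc r}. g i j) = (\<Sum>i<r. \<Sum>j\<in>{Suc i..<Suc r}. g i j)"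
    by simp
  also have "\<dots> = (\<Sum>i<r. (\<Sum>j\<in>{Suc i..<r}. g i j) + g i r)"
    by (intro sum.cong) simp_all
  finally show ?thesis by (simp add: sum.distrib)
qed

lemma length_index_pairs: "length (index_pairs r) = r choose 2"
proof -
  have "(\<Sum>i<r. \<Sum>j\<in>{Suc i..<r}. 1) = r choose 2"
  proof (induction r)
    case (Suc r)
    show ?case
      unfolding sum_less_pairs_Suc Suc.IH by (simp add: numeral_2_eq_2)
  qed (simp add: numeral_2_eq_2)
  then show ?thesis using sum_index_pairs[of "\<lambda>_. 1::nat" r] by simp
qed

lemma real_choose_two: "real (r choose 2) = real r * (real r - 1) / 2"
  by (induction r) (simp_all add: numeral_2_eq_2 field_simps)

definition pair_fst :: "nat \<Rightarrow> nat \<Rightarrow> nat" where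
  "pair_fst r t = fst (index_pairs r ! t)"

definition pair_snd :: "nat \<Rightarrow> nat \<Rightarrow> nat" where
  "pair_snd r t = snd (index_pairs r ! t)"

text \<open>The bilinear form of the matrix identity
  \<open>\<Sum>\<^sub>i\<^sub><\<^sub>j (e\<^sub>i - e\<^sub>j)(e\<^sub>i - e\<^sub>j)\<^sup>T = r I - J\<close>, with \<open>J\<close> the all-ones
  matrix. Taking \<open>a = b\<close> gives the norm identity behind extremality, and taking unit vectors
  and their differences gives the products behind the two ranks.\<close>

lemma lagrange_identity:
  fixes a b :: "nat \<Rightarrow> real"
  shows "(\<Sum>t<r choose 2. (a (pair_fst r t) - a (pair_snd r t)) * (b (pair_fst r t) - b (pair_snd r t)))
    = real r * (\<Sum>i<r. a i * b i) - (\<Sum>i<r. a i) * (\<Sum>i<r. b i)"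
proof -
  have "(\<Sum>i<r. \<Sum>j\<in>{Suc i..<r}. (a i - a j) * (b i - b j))
    = real r * (\<Sum>i<r. a i * b i) - (\<Sum>i<r. a i) * (\<Sum>i<r. b i)"
  proof (induction r)
    case (Suc r)
    have "(\<Sum>i<r. (a i - a r) * (b i - b r))
      = (\<Sum>i<r. a i * b i) - (\<Sum>i<r. a i) * b r - a r * (\<Sum>i<r. b i) + real r * (a r * b r)"
      by (simp add: algebra_simps sum.distrib sum_subtractf sum_distrib_left)
    then show ?case
      unfolding sum_less_pairs_Suc Suc.IH by (simp add: algebra_simps)
  qed simp
  then show ?thesis
    using sum_index_pairs[of "\<lambda>(i, j). (a i - a j) * (b i - b j)" r]
    by (simp add: length_index_pairs pair_fst_def pair_snd_def case_prod_unfold)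
qed

lemma pair_less:
  assumes "t < r choose 2"
  shows "pair_fst r t < pair_snd r t" "pair_snd r t < r" "pair_fst r t < r"
proof -
  have "index_pairs r ! t \<in> set (index_pairs r)"
    using assms by (simp add: length_index_pairs)
  then show "pair_fst r t < pair_snd r t" "pair_snd r t < r" "pair_fst r t < r"
    by (auto simp: index_pairs_def pair_fst_def pair_snd_def)
qed

lemma pair_exists:
  assumes "i < j" "j < r"
  obtains t where "t < r choose 2" "pair_fst r t = i" "pair_snd r t = j"
proof -
  have "(i, j) \<in> set (index_pairs r)" using assms by (force simp: index_pairs_def)
  then obtain t where "t < length (index_pairs r)" "index_pairs r ! t = (i, j)"
    by (auto simp: in_set_conv_nth)
  then show ?thesis using that by (simp add: length_index_pairs pair_fst_def pair_snd_def)
qed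

section \<open>Coordinates\<close>

definition dot :: "nat \<Rightarrow> (nat \<Rightarrow> real) \<Rightarrow> (nat \<Rightarrow> real) \<Rightarrow> real" where
  "dot d a b = (\<Sum>k<d. a k * b k)"

text \<open>Coordinate functions replace vectors of type \<open>real vec\<close>, so that sums of squares can be expanded
  without carrier conditions.\<close>

lemma Cor_iff:
  "C \<in> Cor m n \<longleftrightarrow> C \<in> carrier_mat m n \<and>
     (\<exists>d\<ge>1. \<exists>x y. (\<forall>s<m. dot d (x s) (x s) = 1) \<and> (\<forall>t<n. dot d (y t) (y t) = 1) \<and>
       (\<forall>s<m. \<forall>t<n. C $$ (s, t) = dot d (x s) (y t)))" (is "?L \<longleftrightarrow> ?R")
proof
  assume ?L
  then obtain d x y where C: "C \<in> carrier_mat m n" "d \<ge> 1"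
    and x: "\<forall>s<m. x s \<in> carrier_vec d \<and> unit_vector (x s)"
    and y: "\<forall>t<n. y t \<in> carrier_vec d \<and> unit_vector (y t)"
    and e: "\<forall>s<m. \<forall>t<n. C $$ (s, t) = x s \<bullet> y t"
    unfolding Cor_def by blast
  have sp: "v \<bullet> w = dot d (\<lambda>k. v $ k) (\<lambda>k. w $ k)" if "w \<in> carrier_vec d" for v w
    using that by (simp add: scalar_prod_def dot_def atLeast0LessThan)
  have "(\<forall>s<m. dot d (\<lambda>k. x s $ k) (\<lambda>k. x s $ k) = 1) \<and>
      (\<forall>t<n. dot d (\<lambda>k. y t $ k) (\<lambda>k. y t $ k) = 1) \<and>
      (\<forall>s<m. \<forall>t<n. C $$ (s, t) = dot d (\<lambda>k. x s $ k) (\<lambda>k. y t $ k))"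
    using x y e sp by (auto simp: unit_vector_def)
  then show ?R
    using C by (intro conjI exI[of _ d] exI[of _ "\<lambda>s k. x s $ k"] exI[of _ "\<lambda>t k. y t $ k"]) auto
next
  assume ?R
  then obtain d x y where C: "C \<in> carrier_mat m n" "d \<ge> 1"
    and x: "\<forall>s<m. dot d (x s) (x s) = 1" and y: "\<forall>t<n. dot d (y t) (y t) = 1"
    and e: "\<forall>s<m. \<forall>t<n. C $$ (s, t) = dot d (x s) (y t)" by blast
  have sp: "vec d a \<bullet> vec d b = dot d a b" for a b
    by (simp add: scalar_prod_def dot_def atLeast0LessThan)
  show ?L
    unfolding Cor_def unit_vector_def
    using C x y e
    by (intro CollectI conjI exI[of _ d] exI[of _ "\<lambda>s. vec d (x s)"] exI[of _ "\<lambda>t. vec d (y t)"])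
       (auto simp: sp)
qed

lemma CorE:
  assumes "A \<in> Cor m n"
  obtains d x y where "A \<in> carrier_mat m n"
    "\<forall>s<m. dot d (x s) (x s) = 1" "\<forall>t<n. dot d (y t) (y t) = 1"
    "\<forall>s<m. \<forall>t<n. A $$ (s, t) = dot d (x s) (y t)"
  using assms unfolding Cor_iff by blast

text \<open>\<open>kron i\<close> is the coordinate function of the standard unit vector \<open>e\<^sub>i\<close>.\<close>

definition kron :: "nat \<Rightarrow> nat \<Rightarrow> real" where
  "kron i k = (if i = k then 1 else 0)"

lemma kron_same [simp]: "kron i i = 1"
  by (simp add: kron_def)

lemma kron_neq: "i \<noteq> k \<Longrightarrow> kron i k = 0"
  by (simp add: kron_def)

lemma kron_commute: "kron i k = kron k i"
  by (simp add: kron_def)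

lemma sum_kron:
  assumes "i < r"
  shows "(\<Sum>k<r. kron i k * f k) = f i" "(\<Sum>k<r. f k * kron i k) = f i" "(\<Sum>k<r. kron i k) = 1"
  using assms by (simp_all add: kron_def if_distrib[of "\<lambda>z. z * _"] if_distrib[of "\<lambda>z. _ * z"] cong: if_cong)

section \<open>Exposed points\<close>

text \<open>A proper average of two values that are at most \<open>L C\<close> equals \<open>L C\<close> only if both do.\<close>

lemma extreme_point_of_exposed:
  fixes L :: "real mat \<Rightarrow> real"
  assumes C: "C \<in> S"
    and affine: "\<And>A B u. A \<in> S \<Longrightarrow> B \<in> S \<Longrightarrow> L ((1 - u) \<cdot>\<^sub>m A + u \<cdot>\<^sub>m B) = (1 - u) * L A + u * L B"
    and le: "\<And>A. A \<in> S \<Longrightarrow> L A \<le> L C"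
    and uniq: "\<And>A. A \<in> S \<Longrightarrow> L A = L C \<Longrightarrow> A = C"
  shows "extreme_point_mat C S"
  unfolding extreme_point_mat_def
proof (intro conjI C ballI notI)
  fix A B assume A: "A \<in> S" and B: "B \<in> S"
    and "A \<noteq> B \<and> (\<exists>u>0. u < 1 \<and> C = (1 - u) \<cdot>\<^sub>m A + u \<cdot>\<^sub>m B)"
  then obtain u where ne: "A \<noteq> B" and u: "0 < u" "u < 1" and eq: "C = (1 - u) \<cdot>\<^sub>m A + u \<cdot>\<^sub>m B"
    by blast
  have "L C = (1 - u) * L A + u * L B"
    using affine[OF A B, of u] eq by simp
  then have "(1 - u) * (L C - L A) + u * (L C - L B) = 0"
    by (simp add: algebra_simps)
  moreover have "(1 - u) * (L C - L A) \<ge> 0" "u * (L C - L B) \<ge> 0"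
    using le[OF A] le[OF B] u by simp_all
  ultimately have "(1 - u) * (L C - L A) = 0" "u * (L C - L B) = 0"
    by linarith+
  then have "L A = L C" "L B = L C" using u by simp_all
  then show False using uniq[OF A] uniq[OF B] ne by blast
qed

section \<open>Residuals as sums of squares\<close>

text \<open>The pairwise inner products of the \<open>x s\<close> enter only through the norm of their sum, by Lagrange's
  identity in each coordinate. The other terms are constants and a linear functional of the
  correlations.\<close>

lemma pair_residual:
  fixes x y :: "nat \<Rightarrow> nat \<Rightarrow> real"
  assumes x: "\<forall>s<r. dot d (x s) (x s) = 1"
    and y: "\<forall>t<r choose 2. dot d (y t) (y t) = 1"
  shows "(\<Sum>t<r choose 2. \<Sum>k<d. (\<kappa> * y t k - (x (pair_fst r t) k - x (pair_snd r t) k))\<^sup>2)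
    = \<kappa>\<^sup>2 * (real r * (real r - 1) / 2) + r\<^sup>2 - (\<Sum>k<d. (\<Sum>s<r. x s k)\<^sup>2)
      - 2 * (\<Sum>t<r choose 2. \<kappa> * (dot d (x (pair_fst r t)) (y t) - dot d (x (pair_snd r t)) (y t)))"
proof -
  let ?i = "pair_fst r" and ?j = "pair_snd r"
  have "(\<Sum>k<d. (\<kappa> * y t k - (x (?i t) k - x (?j t) k))\<^sup>2)
      = \<kappa>\<^sup>2 * dot d (y t) (y t) + (\<Sum>k<d. (x (?i t) k - x (?j t) k) * (x (?i t) k - x (?j t) k))
        - 2 * (\<kappa> * (dot d (x (?i t)) (y t) - dot d (x (?j t)) (y t)))" for t
  proof -
    have "(\<Sum>k<d. (\<kappa> * y t k - (x (?i t) k - x (?j t) k))\<^sup>2)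
        = (\<Sum>k<d. \<kappa>\<^sup>2 * (y t k * y t k) + (x (?i t) k - x (?j t) k) * (x (?i t) k - x (?j t) k)
            - 2 * \<kappa> * (x (?i t) k * y t k - x (?j t) k * y t k))"
      by (intro sum.cong) (simp_all add: power2_eq_square algebra_simps)
    then show ?thesis
      by (simp add: dot_def sum.distrib sum_subtractf sum_distrib_left[symmetric])
  qed
  then have "(\<Sum>t<r choose 2. \<Sum>k<d. (\<kappa> * y t k - (x (?i t) k - x (?j t) k))\<^sup>2)
      = (\<Sum>t<r choose 2. \<kappa>\<^sup>2 * dot d (y t) (y t))
        + (\<Sum>t<r choose 2. \<Sum>k<d. (x (?i t) k - x (?j t) k) * (x (?i t) k - x (?j t) k))
        - 2 * (\<Sum>t<r choose 2. \<kappa> * (dot d (x (?i t)) (y t) - dot d (x (?j t)) (y t)))"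
    by (simp add: sum.distrib sum_subtractf sum_distrib_left[symmetric])
  moreover have "(\<Sum>t<r choose 2. \<kappa>\<^sup>2 * dot d (y t) (y t)) = \<kappa>\<^sup>2 * (real r * (real r - 1) / 2)"
    using y by (simp add: real_choose_two)
  moreover have "(\<Sum>t<r choose 2. \<Sum>k<d. (x (?i t) k - x (?j t) k) * (x (?i t) k - x (?j t) k))
      = r\<^sup>2 - (\<Sum>k<d. (\<Sum>s<r. x s k)\<^sup>2)"
  proof -
    have "(\<Sum>t<r choose 2. \<Sum>k<d. (x (?i t) k - x (?j t) k) * (x (?i t) k - x (?j t) k))
        = (\<Sum>k<d. real r * (\<Sum>s<r. x s k * x s k) - (\<Sum>s<r. x s k) * (\<Sum>s<r. x s k))"
      by (subst sum.swap) (simp add: lagrange_identity[of "\<lambda>s. x s _" r "\<lambda>s. x s _"])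
    also have "\<dots> = real r * (\<Sum>s<r. dot d (x s) (x s)) - (\<Sum>k<d. (\<Sum>s<r. x s k)\<^sup>2)"
    proof -
      have "(\<Sum>k<d. \<Sum>s<r. x s k * x s k) = (\<Sum>s<r. dot d (x s) (x s))"
        unfolding dot_def by (rule sum.swap)
      then show ?thesis
        by (simp add: sum_subtractf sum_distrib_left[symmetric] power2_eq_square)
    qed
    also have "(\<Sum>s<r. dot d (x s) (x s)) = r" using x by simp
    finally show ?thesis by (simp add: power2_eq_square)
  qed
  ultimately show ?thesis by simp
qed

text \<open>If the residual vanishes then \<open>\<kappa> y = x i - x j\<close> for every pair. Comparing norms determines the
  inner products of the \<open>x s\<close>, and these determine the correlations.\<close>

lemma pair_residual_zero_imp_Gram:
  fixes x y :: "nat \<Rightarrow> nat \<Rightarrow> real"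
  assumes x: "\<forall>s<r. dot d (x s) (x s) = 1"
    and y: "\<forall>t<r choose 2. dot d (y t) (y t) = 1"
    and zero: "(\<Sum>t<r choose 2. \<Sum>k<d. (\<kappa> * y t k - (x (pair_fst r t) k - x (pair_snd r t) k))\<^sup>2) = 0"
  shows "\<And>s s'. s < r \<Longrightarrow> s' < r \<Longrightarrow> dot d (x s) (x s') = 1 - \<kappa>\<^sup>2 / 2 * (1 - kron s s')"
    and "\<And>s t. s < r \<Longrightarrow> t < r choose 2 \<Longrightarrow> \<kappa> \<noteq> 0 \<Longrightarrow>
      dot d (x s) (y t) = \<kappa> / 2 * (kron s (pair_fst r t) - kron s (pair_snd r t))"
proof -
  let ?i = "pair_fst r" and ?j = "pair_snd r"
  have eq: "\<kappa> * y t k = x (?i t) k - x (?j t) k" if "t < r choose 2" "k < d" for t k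
    using zero that by (force simp: sum_nonneg_eq_0_iff sum_nonneg)
  have sym: "dot d a b = dot d b a" for a b
    by (simp add: dot_def mult.commute)
  have less: "dot d (x s) (x s') = 1 - \<kappa>\<^sup>2 / 2" if ss: "s < s'" "s' < r" for s s'
  proof -
    obtain t where t: "t < r choose 2" "?i t = s" "?j t = s'" using pair_exists[OF ss] .
    have "dot d (\<lambda>k. \<kappa> * y t k) (\<lambda>k. \<kappa> * y t k) = dot d (\<lambda>k. x s k - x s' k) (\<lambda>k. x s k - x s' k)"
      using eq[OF t(1)] t(2,3) unfolding dot_def by (intro sum.cong) auto
    moreover have "dot d (\<lambda>k. \<kappa> * y t k) (\<lambda>k. \<kappa> * y t k) = \<kappa>\<^sup>2 * dot d (y t) (y t)"
      by (simp add: dot_def sum_distrib_left power2_eq_square ac_simps)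
    moreover have "dot d (\<lambda>k. x s k - x s' k) (\<lambda>k. x s k - x s' k)
        = dot d (x s) (x s) + dot d (x s') (x s') - 2 * dot d (x s) (x s')"
      by (simp add: dot_def left_diff_distrib right_diff_distrib sum.distrib sum_subtractf mult.commute
          sum_distrib_left)
    ultimately show ?thesis using x[rule_format, of s] x[rule_format, of s'] y[rule_format, OF t(1)] ss by (simp add: field_simps)
  qed
  show gram: "dot d (x s) (x s') = 1 - \<kappa>\<^sup>2 / 2 * (1 - kron s s')" if "s < r" "s' < r" for s s'
    using less[of s s'] less[of s' s] x[rule_format, of s] that sym[of "x s" "x s'"]
    by (cases s s' rule: linorder_cases) (auto simp: kron_neq)
  show "dot d (x s) (y t) = \<kappa> / 2 * (kron s (?i t) - kron s (?j t))"
    if s: "s < r" and t: "t < r choose 2" and \<kappa>: "\<kappa> \<noteq> 0" for s t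
  proof -
    have "\<kappa> * dot d (x s) (y t) = (\<Sum>k<d. x s k * (\<kappa> * y t k))"
      by (simp add: dot_def sum_distrib_left ac_simps)
    also have "\<dots> = (\<Sum>k<d. x s k * (x (?i t) k - x (?j t) k))"
      using eq[OF t] by simp
    also have "\<dots> = dot d (x s) (x (?i t)) - dot d (x s) (x (?j t))"
      by (simp add: dot_def sum_subtractf right_diff_distrib)
    also have "\<dots> = \<kappa> * (\<kappa> / 2 * (kron s (?i t) - kron s (?j t)))"
      using gram[OF s, of "?i t"] gram[OF s, of "?j t"] pair_less[OF t]
      by (simp add: power2_eq_square field_simps)
    finally show ?thesis using \<kappa> by simp
  qed
qed

text \<open>Adding this to the residual of the pairs cancels the norm of the sum of the \<open>x s\<close>.\<close>

lemma sum_residual: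
  fixes x :: "nat \<Rightarrow> nat \<Rightarrow> real"
  assumes "dot d y y = 1"
  shows "(\<Sum>k<d. (c * y k - (\<Sum>s<r. x s k))\<^sup>2)
    = c\<^sup>2 + (\<Sum>k<d. (\<Sum>s<r. x s k)\<^sup>2) - 2 * (c * (\<Sum>s<r. dot d (x s) y))"
proof -
  have "(\<Sum>s<r. dot d (x s) y) = (\<Sum>k<d. (\<Sum>s<r. x s k) * y k)"
    unfolding dot_def sum_distrib_right by (rule sum.swap)
  moreover have "(\<Sum>k<d. (c * y k - (\<Sum>s<r. x s k))\<^sup>2)
      = (\<Sum>k<d. c\<^sup>2 * (y k * y k) + (\<Sum>s<r. x s k)\<^sup>2 - 2 * c * ((\<Sum>s<r. x s k) * y k))"
    by (intro sum.cong) (simp_all add: power2_eq_square algebra_simps)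
  ultimately show ?thesis using assms
    by (simp add: dot_def sum.distrib sum_subtractf sum_distrib_left[symmetric])
qed

section \<open>The exposing functional\<close>

text \<open>This is the linear part of the residual over the pairs, as a function of the correlations.\<close>

definition pair_functional :: "nat \<Rightarrow> real \<Rightarrow> real mat \<Rightarrow> real" where
  "pair_functional r \<kappa> A =
     (\<Sum>t<r choose 2. \<kappa> * (A $$ (pair_fst r t, t) - A $$ (pair_snd r t, t)))"

lemma pair_functional_affine:
  assumes "A \<in> carrier_mat r n" "B \<in> carrier_mat r n" "r choose 2 \<le> n"
  shows "pair_functional r \<kappa> ((1 - u) \<cdot>\<^sub>m A + u \<cdot>\<^sub>m B)
    = (1 - u) * pair_functional r \<kappa> A + u * pair_functional r \<kappa> B"
proof -
  have "pair_functional r \<kappa> ((1 - u) \<cdot>\<^sub>m A + u \<cdot>\<^sub>m B)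
      = (\<Sum>t<r choose 2. (1 - u) * (\<kappa> * (A $$ (pair_fst r t, t) - A $$ (pair_snd r t, t)))
          + u * (\<kappa> * (B $$ (pair_fst r t, t) - B $$ (pair_snd r t, t))))"
    unfolding pair_functional_def
  proof (rule sum.cong)
    fix t assume "t \<in> {..<r choose 2}"
    then have "pair_fst r t < r" "pair_snd r t < r" "t < n"
      using pair_less[of t r] assms(3) by auto
    then show "\<kappa> * (((1 - u) \<cdot>\<^sub>m A + u \<cdot>\<^sub>m B) $$ (pair_fst r t, t)
          - ((1 - u) \<cdot>\<^sub>m A + u \<cdot>\<^sub>m B) $$ (pair_snd r t, t))
        = (1 - u) * (\<kappa> * (A $$ (pair_fst r t, t) - A $$ (pair_snd r t, t)))
          + u * (\<kappa> * (B $$ (pair_fst r t, t) - B $$ (pair_snd r t, t)))"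
      using assms(1,2) by (simp add: algebra_simps)
  qed simp
  then show ?thesis
    by (simp add: pair_functional_def sum.distrib sum_distrib_left)
qed

lemma pair_functional_value:
  assumes "\<And>s t. s < r \<Longrightarrow> t < r choose 2 \<Longrightarrow>
    A $$ (s, t) = \<kappa> / 2 * (kron s (pair_fst r t) - kron s (pair_snd r t))"
  shows "pair_functional r \<kappa> A = \<kappa>\<^sup>2 * (real r * (real r - 1) / 2)"
proof -
  have "\<kappa> * (A $$ (pair_fst r t, t) - A $$ (pair_snd r t, t)) = \<kappa>\<^sup>2" if "t < r choose 2" for t
    using pair_less[OF that] assms[of "pair_fst r t" t] assms[of "pair_snd r t" t] that
    by (simp add: kron_neq power2_eq_square)
  then show ?thesis by (simp add: pair_functional_def real_choose_two)
qed

section \<open>The matrices\<close>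

lemma unit_vec_entry: "s < r \<Longrightarrow> unit_vec r i $ s = kron s i"
  by (simp add: unit_vec_def kron_def)

lemma C1_mat_carrier: "C1_mat r \<in> carrier_mat r ((r choose 2) + 1)"
  by (intro carrier_matI) (simp_all add: C1_mat_def length_index_pairs)

lemma C2_mat_carrier: "C2_mat r \<in> carrier_mat r (r choose 2)"
  by (intro carrier_matI) (simp_all add: C2_mat_def length_index_pairs)

lemma C1_mat_pair_entry:
  assumes "s < r" "t < r choose 2"
  shows "C1_mat r $$ (s, t) = sqrt 2 / 2 * (kron s (pair_fst r t) - kron s (pair_snd r t))"
proof -
  have "C1_mat r $$ (s, t) = 1 / sqrt 2 * (kron s (pair_fst r t) - kron s (pair_snd r t))"
    using assms
    by (simp add: C1_mat_def mat_of_cols_index nth_append length_index_pairs pair_fst_def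
        pair_snd_def case_prod_unfold unit_vec_entry)
  moreover have "1 / sqrt 2 = sqrt 2 / 2" by (simp add: field_simps)
  ultimately show ?thesis by metis
qed

lemma C2_mat_entry:
  assumes "s < r" "t < r choose 2"
  shows "C2_mat r $$ (s, t)
    = - sqrt (real r / (2 * (real r - 1))) * (kron s (pair_fst r t) - kron s (pair_snd r t))"
  using assms
  by (simp add: C2_mat_def mat_of_cols_index length_index_pairs pair_fst_def
      pair_snd_def case_prod_unfold unit_vec_entry)

lemma C1_mat_last_entry:
  assumes "s < r"
  shows "C1_mat r $$ (s, r choose 2) = 1 / sqrt r"
proof -
  let ?v = "finsum_vec TYPE(real) r (unit_vec r) {0..<r}"
  have v: "?v \<in> carrier_vec r" by (rule finsum_vec_closed) auto
  have "?v $ s = (\<Sum>i\<in>{0..<r}. unit_vec r i $ s)"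
    using assms by (intro index_finsum_vec) auto
  also have "\<dots> = (\<Sum>i<r. kron s i)"
    using assms by (simp only: atLeast0LessThan unit_vec_entry)
  also have "\<dots> = 1" using sum_kron(3)[OF assms] .
  finally have "?v $ s = 1" .
  moreover have "C1_mat r $$ (s, r choose 2) = ((1 / sqrt (real r)) \<cdot>\<^sub>v ?v) $ s"
    using assms by (simp add: C1_mat_def mat_of_cols_index nth_append length_index_pairs)
  ultimately show ?thesis using v assms by simp
qed

lemma dot_kron: "s < r \<Longrightarrow> dot r (kron s) f = f s"
  by (simp add: dot_def sum_kron)

lemma dot_kron_diff:
  assumes "i < r" "j < r"
  shows "dot r f (\<lambda>k. c * (kron i k - kron j k)) = c * (f i - f j)"
proof -
  have "dot r f (\<lambda>k. c * (kron i k - kron j k)) = (\<Sum>k<r. c * (f k * kron i k - f k * kron j k))"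
    unfolding dot_def by (intro sum.cong) (simp_all add: algebra_simps)
  then show ?thesis using assms
    by (simp add: sum_distrib_left[symmetric] sum_subtractf sum_kron)
qed

lemma C1_mat_in_Cor:
  assumes "r \<ge> 1"
  shows "C1_mat r \<in> Cor r ((r choose 2) + 1)"
proof -
  define y where "y = (\<lambda>t k. if t < r choose 2
    then sqrt 2 / 2 * (kron (pair_fst r t) k - kron (pair_snd r t) k) else 1 / sqrt r)"
  have "dot r (kron s) (kron s) = 1" if "s < r" for s
    using that by (simp add: dot_kron)
  moreover have "dot r (y t) (y t) = 1" if "t < (r choose 2) + 1" for t
  proof (cases "t < r choose 2")
    case True
    then have "y t = (\<lambda>k. sqrt 2 / 2 * (kron (pair_fst r t) k - kron (pair_snd r t) k))"
      by (simp add: y_def)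
    then show ?thesis using pair_less[OF True]
      by (simp only: dot_kron_diff) (simp add: kron_neq)
  next
    case False
    then show ?thesis using assms by (simp add: y_def dot_def)
  qed
  moreover have "C1_mat r $$ (s, t) = dot r (kron s) (y t)" if "s < r" "t < (r choose 2) + 1" for s t
  proof (cases "t < r choose 2")
    case True
    then show ?thesis using that
      by (simp add: dot_kron y_def C1_mat_pair_entry kron_commute[of s])
  next
    case False
    then have "t = r choose 2" using that by simp
    then show ?thesis using that by (simp add: dot_kron y_def C1_mat_last_entry)
  qed
  ultimately show ?thesis
    unfolding Cor_iff using C1_mat_carrier assms by blast
qed

text \<open>The \<open>x s\<close> are the vertices of a regular simplex centred at the origin: the unit vectors,
  translated by their barycentre and rescaled. Since each \<open>y t\<close> is orthogonal to the barycentre,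
  the translation does not affect the correlations.\<close>

lemma C2_mat_in_Cor:
  assumes "r \<ge> 2"
  shows "C2_mat r \<in> Cor r (r choose 2)"
proof -
  define c where "c = sqrt (real r / (real r - 1))"
  define x where "x = (\<lambda>s k. c * (kron s k - 1 / real r))"
  define y where "y = (\<lambda>t k. - (sqrt 2 / 2) * (kron (pair_fst r t) k - kron (pair_snd r t) k))"
  have c2: "c * c = real r / (real r - 1)" using assms by (simp add: c_def)
  have "dot r (x s) (x s) = 1" if "s < r" for s
  proof -
    have "dot r (x s) (x s)
        = (\<Sum>k<r. c * c * (kron s k * kron s k - 2 / real r * kron s k + 1 / real r * (1 / real r)))"
      unfolding dot_def x_def by (intro sum.cong) (simp_all add: algebra_simps)
    also have "\<dots> = c * c * (1 - 2 / real r + real r * (1 / real r * (1 / real r)))"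
      using that by (simp add: sum_distrib_left[symmetric] sum_divide_distrib[symmetric]
          sum.distrib sum_subtractf sum_kron)
    also have "\<dots> = 1" unfolding c2 using assms by (simp add: field_simps)
    finally show ?thesis .
  qed
  moreover have "dot r (y t) (y t) = 1" if "t < r choose 2" for t
    using pair_less[OF that] unfolding y_def
    by (subst dot_kron_diff) (simp_all add: kron_neq field_simps)
  moreover have "C2_mat r $$ (s, t) = dot r (x s) (y t)" if "s < r" "t < r choose 2" for s t
  proof -
    have "dot r (x s) (y t) = - (sqrt 2 / 2 * c) * (kron s (pair_fst r t) - kron s (pair_snd r t))"
      using pair_less[OF that(2)] unfolding y_def
      by (subst dot_kron_diff) (simp_all add: x_def algebra_simps)
    moreover have "sqrt 2 / 2 * c = sqrt (real r / (2 * (real r - 1)))"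
    proof -
      have "sqrt 2 / 2 = sqrt (1 / 2)" by (simp add: real_sqrt_divide field_simps)
      then have "sqrt 2 / 2 * c = sqrt (1 / 2 * (real r / (real r - 1)))"
        by (simp only: c_def real_sqrt_mult)
      then show ?thesis by simp
    qed
    ultimately show ?thesis using that by (simp add: C2_mat_entry)
  qed
  ultimately show ?thesis
    unfolding Cor_iff using C2_mat_carrier assms by (intro conjI exI[of _ r] exI[of _ x] exI[of _ y]) auto
qed

section \<open>Extremality\<close>

text \<open>The two residuals add up to \<open>2 (r\<^sup>2 - L A)\<close>, so \<open>L\<close> is at most \<open>r\<^sup>2\<close>. At equality the \<open>x s\<close> are
  orthonormal and the last column is determined by \<open>\<surd>r y = \<Sum>\<^sub>s x s\<close>.\<close>

lemma extreme_C1_mat: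
  assumes r: "r \<ge> 1"
  shows "extreme_point_mat (C1_mat r) (Cor r ((r choose 2) + 1))"
proof -
  define L where "L = (\<lambda>A. pair_functional r (sqrt 2) A + sqrt r * (\<Sum>s<r. A $$ (s, r choose 2)))"
  have L_C: "L (C1_mat r) = (real r)\<^sup>2"
  proof -
    have "pair_functional r (sqrt 2) (C1_mat r) = real r * (real r - 1)"
      by (subst pair_functional_value) (simp_all add: C1_mat_pair_entry)
    moreover have "(\<Sum>s<r. C1_mat r $$ (s, r choose 2)) = r * (1 / sqrt r)"
      by (simp add: C1_mat_last_entry)
    ultimately show ?thesis using r
      by (simp add: L_def power2_eq_square algebra_simps)
  qed
  have *: "L A \<le> (real r)\<^sup>2 \<and> (L A = (real r)\<^sup>2 \<longrightarrow> A = C1_mat r)" if A: "A \<in> Cor r ((r choose 2) + 1)" for A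
    using A
  proof (rule CorE)
    fix d x y
    assume Ac: "A \<in> carrier_mat r ((r choose 2) + 1)"
      and x: "\<forall>s<r. dot d (x s) (x s) = 1"
      and y: "\<forall>t<(r choose 2) + 1. dot d (y t) (y t) = 1"
      and e: "\<forall>s<r. \<forall>t<(r choose 2) + 1. A $$ (s, t) = dot d (x s) (y t)"
    have y': "\<forall>t<r choose 2. dot d (y t) (y t) = 1" using y by simp
    define R where "R = (\<Sum>t<r choose 2. \<Sum>k<d.
      (sqrt 2 * y t k - (x (pair_fst r t) k - x (pair_snd r t) k))\<^sup>2)"
    define Q where "Q = (\<Sum>k<d. (sqrt r * y (r choose 2) k - (\<Sum>s<r. x s k))\<^sup>2)"
    have "pair_functional r (sqrt 2) A = (\<Sum>t<r choose 2. sqrt 2 *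
        (dot d (x (pair_fst r t)) (y t) - dot d (x (pair_snd r t)) (y t)))"
      unfolding pair_functional_def using e pair_less by (intro sum.cong) auto
    then have "R = real r * (real r - 1) + (real r)\<^sup>2 - (\<Sum>k<d. (\<Sum>s<r. x s k)\<^sup>2)
        - 2 * pair_functional r (sqrt 2) A"
      using pair_residual[OF x y', of "sqrt 2"] by (simp add: R_def)
    moreover have "Q = real r + (\<Sum>k<d. (\<Sum>s<r. x s k)\<^sup>2)
        - 2 * (sqrt r * (\<Sum>s<r. A $$ (s, r choose 2)))"
      unfolding Q_def by (subst sum_residual) (simp_all add: y e)
    ultimately have RQ: "R + Q = 2 * ((real r)\<^sup>2 - L A)"
      by (simp add: L_def power2_eq_square right_diff_distrib)
    have nonneg: "R \<ge> 0" "Q \<ge> 0" by (simp_all add: R_def Q_def sum_nonneg)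
    have "A = C1_mat r" if "L A = (real r)\<^sup>2"
    proof -
      have R0: "R = 0" and Q0: "Q = 0" using RQ that nonneg by simp_all
      note gram = pair_residual_zero_imp_Gram[OF x y' R0[unfolded R_def]]
      have last: "A $$ (s, r choose 2) = 1 / sqrt r" if s: "s < r" for s
      proof -
        have "sqrt r * y (r choose 2) k = (\<Sum>s<r. x s k)" if "k < d" for k
          using Q0 that unfolding Q_def by (force simp: sum_nonneg_eq_0_iff)
        then have "sqrt r * dot d (x s) (y (r choose 2)) = (\<Sum>k<d. \<Sum>s'<r. x s k * x s' k)"
          by (simp add: dot_def sum_distrib_left[symmetric] mult.left_commute[of "sqrt r"]
              sum_distrib_left[of "sqrt r"])
        also have "\<dots> = (\<Sum>s'<r. dot d (x s) (x s'))"
          unfolding dot_def by (rule sum.swap)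
        also have "\<dots> = (\<Sum>s'<r. kron s s')"
          using gram(1)[OF s] by simp
        also have "\<dots> = 1" using sum_kron(3)[OF s] .
        finally show ?thesis using r s e by (simp add: field_simps)
      qed
      show ?thesis
      proof (rule eq_matI)
        fix s t assume "s < dim_row (C1_mat r)" "t < dim_col (C1_mat r)"
        then have st: "s < r" "t < (r choose 2) + 1" using C1_mat_carrier[of r] by auto
        show "A $$ (s, t) = C1_mat r $$ (s, t)"
        proof (cases "t < r choose 2")
          case True
          then show ?thesis using st gram(2) by (simp add: e C1_mat_pair_entry)
        next
          case False
          then have "t = r choose 2" using st by simp
          then show ?thesis using st last by (simp add: C1_mat_last_entry)
        qed
      qed (use Ac C1_mat_carrier[of r] in auto)
    qed
    then show ?thesis using RQ nonneg by auto
  qed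
  show ?thesis
  proof (rule extreme_point_of_exposed[where L = L])
    show "C1_mat r \<in> Cor r ((r choose 2) + 1)" using C1_mat_in_Cor[OF r] .
    fix A B and u :: real assume AB: "A \<in> Cor r ((r choose 2) + 1)" "B \<in> Cor r ((r choose 2) + 1)"
    then have car: "A \<in> carrier_mat r ((r choose 2) + 1)" "B \<in> carrier_mat r ((r choose 2) + 1)"
      by (simp_all add: Cor_iff)
    then have last: "(\<Sum>s<r. ((1 - u) \<cdot>\<^sub>m A + u \<cdot>\<^sub>m B) $$ (s, r choose 2))
        = (1 - u) * (\<Sum>s<r. A $$ (s, r choose 2)) + u * (\<Sum>s<r. B $$ (s, r choose 2))"
      by (simp add: sum.distrib sum_distrib_left)
    have "pair_functional r (sqrt 2) ((1 - u) \<cdot>\<^sub>m A + u \<cdot>\<^sub>m B)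
        = (1 - u) * pair_functional r (sqrt 2) A + u * pair_functional r (sqrt 2) B"
      using car by (intro pair_functional_affine) auto
    then show "L ((1 - u) \<cdot>\<^sub>m A + u \<cdot>\<^sub>m B) = (1 - u) * L A + u * L B"
      unfolding L_def last by (simp add: distrib_left mult.left_commute)
  qed (use * L_C in auto)
qed

text \<open>The value of \<open>\<kappa>\<close> is forced by \<open>C2_mat\<close>, whose entries are \<open>\<kappa> / 2\<close> times those of \<open>e\<^sub>i - e\<^sub>j\<close>. Then
  \<open>R + \<bar>\<Sum>\<^sub>s x s\<bar>\<^sup>2\<close> equals \<open>2 (r\<^sup>2 - L A)\<close> for the pair functional \<open>L\<close>.\<close>

lemma extreme_C2_mat:
  assumes r: "r \<ge> 2"
  shows "extreme_point_mat (C2_mat r) (Cor r (r choose 2))"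
proof -
  define \<kappa> where "\<kappa> = - 2 * sqrt (real r / (2 * (real r - 1)))"
  have \<kappa>2: "\<kappa>\<^sup>2 = 2 * real r / (real r - 1)" and \<kappa>0: "\<kappa> \<noteq> 0"
    using r by (simp_all add: \<kappa>_def power_mult_distrib field_simps)
  have half: "C2_mat r $$ (s, t) = \<kappa> / 2 * (kron s (pair_fst r t) - kron s (pair_snd r t))"
    if "s < r" "t < r choose 2" for s t
    using that by (simp add: C2_mat_entry \<kappa>_def)
  have sq: "\<kappa>\<^sup>2 * (real r * (real r - 1) / 2) = (real r)\<^sup>2"
    unfolding \<kappa>2 using r by (simp add: power2_eq_square)
  have L_C: "pair_functional r \<kappa> (C2_mat r) = (real r)\<^sup>2"
    using pair_functional_value[of r "C2_mat r" \<kappa>] half sq by simp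
  have *: "pair_functional r \<kappa> A \<le> (real r)\<^sup>2 \<and> (pair_functional r \<kappa> A = (real r)\<^sup>2 \<longrightarrow> A = C2_mat r)"
    if A: "A \<in> Cor r (r choose 2)" for A
    using A
  proof (rule CorE)
    fix d x y
    assume Ac: "A \<in> carrier_mat r (r choose 2)"
      and x: "\<forall>s<r. dot d (x s) (x s) = 1"
      and y: "\<forall>t<r choose 2. dot d (y t) (y t) = 1"
      and e: "\<forall>s<r. \<forall>t<r choose 2. A $$ (s, t) = dot d (x s) (y t)"
    define R where "R = (\<Sum>t<r choose 2. \<Sum>k<d.
      (\<kappa> * y t k - (x (pair_fst r t) k - x (pair_snd r t) k))\<^sup>2)"
    define P where "P = (\<Sum>k<d. (\<Sum>s<r. x s k)\<^sup>2)"
    have "pair_functional r \<kappa> A = (\<Sum>t<r choose 2. \<kappa> *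
        (dot d (x (pair_fst r t)) (y t) - dot d (x (pair_snd r t)) (y t)))"
      unfolding pair_functional_def using e pair_less by (intro sum.cong) auto
    then have RP: "R + P = 2 * ((real r)\<^sup>2 - pair_functional r \<kappa> A)"
      using pair_residual[OF x y, of \<kappa>] sq unfolding R_def P_def by simp
    have nonneg: "R \<ge> 0" "P \<ge> 0" by (simp_all add: R_def P_def sum_nonneg)
    have "A = C2_mat r" if "pair_functional r \<kappa> A = (real r)\<^sup>2"
    proof -
      have R0: "R = 0" using RP that nonneg by simp
      note gram = pair_residual_zero_imp_Gram(2)[OF x y R0[unfolded R_def]]
      show ?thesis
        using Ac C2_mat_carrier[of r] gram \<kappa>0 by (intro eq_matI) (auto simp: e half)
    qed
    then show ?thesis using RP nonneg by auto
  qed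
  show ?thesis
  proof (rule extreme_point_of_exposed[where L = "pair_functional r \<kappa>"])
    show "C2_mat r \<in> Cor r (r choose 2)" using C2_mat_in_Cor[OF r] .
    fix A B and u :: real assume "A \<in> Cor r (r choose 2)" "B \<in> Cor r (r choose 2)"
    then show "pair_functional r \<kappa> ((1 - u) \<cdot>\<^sub>m A + u \<cdot>\<^sub>m B)
        = (1 - u) * pair_functional r \<kappa> A + u * pair_functional r \<kappa> B"
      by (intro pair_functional_affine) (auto simp: Cor_iff)
  qed (use * L_C in auto)
qed

text \<open>This covers \<open>C2_mat 1\<close>, where the simplex degenerates and \<open>\<surd>(r / (r - 1))\<close> is meaningless.\<close>

lemma extreme_point_mat_no_columns:
  assumes "A \<in> carrier_mat m 0"
  shows "extreme_point_mat A (Cor m 0)"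
proof -
  have "A \<in> Cor m 0"
    unfolding Cor_iff using assms
    by (intro conjI exI[of _ 1] exI[of _ "\<lambda>_ _. 1"]) (auto simp: dot_def)
  moreover have "X = Y" if "X \<in> Cor m 0" "Y \<in> Cor m 0" for X Y
    using that by (intro eq_matI) (auto simp: Cor_iff)
  ultimately show ?thesis unfolding extreme_point_mat_def by blast
qed

section \<open>Ranks\<close>

text \<open>The two factorizations give \<open>A\<close> and \<open>B\<close> the same column space, and the left inverse makes the
  columns of \<open>B\<close> a basis of it.\<close>

lemma rank_eq_of_factorization:
  fixes A :: "real mat"
  assumes A: "A \<in> carrier_mat n m" and B: "B \<in> carrier_mat n k"
    and D: "D \<in> carrier_mat k m" and E: "E \<in> carrier_mat m k" and F: "F \<in> carrier_mat k n"
    and AB: "A = B * D" and BA: "B = A * E" and FB: "F * B = 1\<^sub>m k"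
  shows "vec_space.rank n A = k"
proof -
  interpret vec_space "TYPE(real)" n .
  have inj: "v = 0\<^sub>v k" if "v \<in> carrier_vec k" "B *\<^sub>v v = 0\<^sub>v n" for v
  proof -
    have "v = F * B *\<^sub>v v" using that FB by simp
    also have "\<dots> = F *\<^sub>v (B *\<^sub>v v)" using that F B by simp
    also have "\<dots> = 0\<^sub>v k" using that F by auto
    finally show ?thesis .
  qed
  have dist: "distinct (cols B)"
  proof (subst distinct_conv_nth, intro allI impI notI)
    fix i j assume ij: "i < length (cols B)" "j < length (cols B)" "i \<noteq> j" "cols B ! i = cols B ! j"
    then have k: "i < k" "j < k" "col B i = col B j" using B by auto
    have "col (F * B) i = col (F * B) j"
      using k F B by (simp add: col_mult2)
    then have "unit_vec k i = (unit_vec k j :: real vec)" using k FB by simp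
    then have "unit_vec k i $ i = (unit_vec k j $ i :: real)" by simp
    then show False using k ij(3) by simp
  qed
  have indpt: "lin_indpt (set (cols B))"
    using lin_depE[OF B _ dist] inj by metis
  have sub: "set (cols (X * Y)) \<subseteq> span (set (cols X))"
    if X: "X \<in> carrier_mat n p" and Y: "Y \<in> carrier_mat p q" for X Y p q
  proof
    fix v assume "v \<in> set (cols (X * Y))"
    then obtain j where j: "j < q" "v = col (X * Y) j"
      using X Y by (auto simp: in_set_conv_nth)
    then have v: "v = X *\<^sub>v col Y j" using col_mult2[OF X Y] by simp
    have "v \<in> col_space X"
      unfolding col_space_eq[OF X] v using X Y j by (auto intro!: bexI[of _ "col Y j"])
    then show "v \<in> span (set (cols X))" by (simp add: col_space_def)
  qed
  have "span (set (cols A)) = span (set (cols B))"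
    using sub[OF B D] sub[OF A E] A B cols_dim[of A] cols_dim[of B]
    by (intro equalityI span_subsetI) (auto simp: AB[symmetric] BA[symmetric])
  then have "rank A = rank B" by (simp add: rank_def)
  then show ?thesis using lin_indpt_full_rank[OF B dist indpt] by simp
qed

lemma mult_entry:
  fixes A B :: "real mat"
  assumes "A \<in> carrier_mat n m" "B \<in> carrier_mat m k" "i < n" "j < k"
  shows "(A * B) $$ (i, j) = (\<Sum>t<m. A $$ (i, t) * B $$ (t, j))"
  using assms by (simp add: scalar_prod_def atLeast0LessThan)

text \<open>The transpose of \<open>C1_mat\<close>, with its rows rescaled, is a right inverse: the pairs contribute
  \<open>I - J / r\<close> by Lagrange's identity, with \<open>J\<close> the all-ones matrix, and the last column contributes
  \<open>J / r\<close>.\<close>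

lemma rank_C1_mat:
  assumes r: "r \<ge> 1"
  shows "vec_space.rank r (C1_mat r) = r"
proof -
  define E where "E = mat ((r choose 2) + 1) r (\<lambda>(t, s).
    if t < r choose 2 then sqrt 2 / r * (kron s (pair_fst r t) - kron s (pair_snd r t)) else 1 / sqrt r)"
  have E: "E \<in> carrier_mat ((r choose 2) + 1) r" by (simp add: E_def)
  have CE: "1\<^sub>m r = C1_mat r * E"
  proof (rule eq_matI)
    fix s s' assume "s < dim_row (C1_mat r * E)" "s' < dim_col (C1_mat r * E)"
    then have s: "s < r" "s' < r" using C1_mat_carrier[of r] E by auto
    have "(C1_mat r * E) $$ (s, s') = (\<Sum>t<r choose 2. C1_mat r $$ (s, t) * E $$ (t, s')) + 1 / r"
      unfolding mult_entry[OF C1_mat_carrier E s] using s by (simp add: C1_mat_last_entry E_def)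
    also have "(\<Sum>t<r choose 2. C1_mat r $$ (s, t) * E $$ (t, s')) = (\<Sum>t<r choose 2. 1 / r *
        ((kron s (pair_fst r t) - kron s (pair_snd r t)) * (kron s' (pair_fst r t) - kron s' (pair_snd r t))))"
    proof (intro sum.cong)
      have "sqrt 2 / 2 * a * (sqrt 2 / real r * b) = sqrt 2 * sqrt 2 / 2 * (1 / r * (a * b))" for a b
        by (simp only: divide_inverse ac_simps)
      then show "C1_mat r $$ (s, t) * E $$ (t, s') = 1 / r *
        ((kron s (pair_fst r t) - kron s (pair_snd r t)) * (kron s' (pair_fst r t) - kron s' (pair_snd r t)))"
        if "t \<in> {..<r choose 2}" for t
        using s that by (simp add: C1_mat_pair_entry E_def)
    qed simp
    also have "\<dots> = 1 / r * (r * kron s s' - 1)"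
      unfolding sum_distrib_left[symmetric] lagrange_identity
      using s by (simp add: sum_kron kron_commute[of s' s])
    finally show "1\<^sub>m r $$ (s, s') = (C1_mat r * E) $$ (s, s')"
      using s r by (simp add: kron_def field_simps)
  qed (use C1_mat_carrier[of r] E in auto)
  show ?thesis
    by (rule rank_eq_of_factorization[OF C1_mat_carrier one_carrier_mat C1_mat_carrier E one_carrier_mat _ CE])
      (use C1_mat_carrier[of r] in auto)
qed

text \<open>The columns of \<open>C2_mat\<close> have coordinate sum zero, hence lie in the span of the \<open>r - 1\<close> vectors
  \<open>b j\<close>, with coefficients their first \<open>r - 1\<close> coordinates. Conversely Lagrange's identity
  recovers \<open>b j\<close>, because the all-ones matrix annihilates it.\<close>

lemma rank_C2_mat:
  assumes r: "r \<ge> 1"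
  shows "vec_space.rank r (C2_mat r) = r - 1"
proof -
  define c where "c = - sqrt (real r / (2 * (real r - 1)))"
  define b where "b = (\<lambda>j s. kron j s - kron (r - 1) s)"
  define B where "B = mat r (r - 1) (\<lambda>(s, j). b j s)"
  define D where "D = mat (r - 1) (r choose 2) (\<lambda>(j, t). C2_mat r $$ (j, t))"
  define E where "E = mat (r choose 2) (r - 1) (\<lambda>(t, j). 1 / (c * r) * (b j (pair_fst r t) - b j (pair_snd r t)))"
  define F where "F = mat (r - 1) r (\<lambda>(j, s). kron j s)"
  have B: "B \<in> carrier_mat r (r - 1)" and D: "D \<in> carrier_mat (r - 1) (r choose 2)"
    and E: "E \<in> carrier_mat (r choose 2) (r - 1)" and F: "F \<in> carrier_mat (r - 1) r"
    by (simp_all add: B_def D_def E_def F_def)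
  have entry: "C2_mat r $$ (s, t) = c * (kron s (pair_fst r t) - kron s (pair_snd r t))"
    if "s < r" "t < r choose 2" for s t
    using that by (simp add: C2_mat_entry c_def)
  have BD: "C2_mat r = B * D"
  proof (rule eq_matI)
    fix s t assume "s < dim_row (B * D)" "t < dim_col (B * D)"
    then have st: "s < r" "t < r choose 2" using B D by auto
    have "(B * D) $$ (s, t) = (\<Sum>j<r - 1. kron s j * C2_mat r $$ (j, t))
        - kron (r - 1) s * (\<Sum>j<r - 1. C2_mat r $$ (j, t))"
      unfolding mult_entry[OF B D st] using st
      by (simp add: B_def D_def b_def left_diff_distrib sum_subtractf sum_distrib_left kron_commute)
    moreover have "(\<Sum>j<r - 1. C2_mat r $$ (j, t)) + C2_mat r $$ (r - 1, t) = 0"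
    proof -
      have "(\<Sum>j<r - 1. C2_mat r $$ (j, t)) + C2_mat r $$ (r - 1, t) = (\<Sum>j<Suc (r - 1). C2_mat r $$ (j, t))"
        by simp
      also have "\<dots> = (\<Sum>j<r. c * (kron (pair_fst r t) j - kron (pair_snd r t) j))"
        using r st by (intro sum.cong) (auto simp: entry kron_commute)
      also have "\<dots> = 0"
        using pair_less[OF st(2)] by (simp add: sum_distrib_left[symmetric] sum_subtractf sum_kron)
      finally show ?thesis .
    qed
    \<comment> \<open>The rows above the last one are copied by \<open>B\<close>; the last one is minus the sum of the others.\<close>
    ultimately show "C2_mat r $$ (s, t) = (B * D) $$ (s, t)"
    proof (cases "s < r - 1")
      case True
      then show ?thesis
        using \<open>(B * D) $$ (s, t) = _\<close> by (simp add: sum_kron kron_neq)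
    next
      case False
      then have s: "s = r - 1" using st by simp
      have "(\<Sum>j<r - 1. kron s j * C2_mat r $$ (j, t)) = 0"
        unfolding s by (intro sum.neutral) (auto simp: kron_neq)
      then show ?thesis
        using \<open>(B * D) $$ (s, t) = _\<close> \<open>_ + C2_mat r $$ (r - 1, t) = 0\<close> s by simp
    qed
  qed (use C2_mat_carrier[of r] B D in auto)
  have CE: "B = C2_mat r * E"
  proof (rule eq_matI)
    fix s j assume "s < dim_row (C2_mat r * E)" "j < dim_col (C2_mat r * E)"
    then have sj: "s < r" "j < r - 1" using C2_mat_carrier[of r] E by auto
    have c0: "c \<noteq> 0" using sj by (simp add: c_def)
    have b0: "(\<Sum>i<r. b j i) = 0" using sj by (simp add: b_def sum_subtractf sum_kron)
    have "(C2_mat r * E) $$ (s, j) = (\<Sum>t<r choose 2. 1 / r *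
        ((kron s (pair_fst r t) - kron s (pair_snd r t)) * (b j (pair_fst r t) - b j (pair_snd r t))))"
      unfolding mult_entry[OF C2_mat_carrier E sj]
      using sj c0 by (intro sum.cong) (auto simp: entry E_def)
    also have "\<dots> = b j s"
      unfolding sum_distrib_left[symmetric] lagrange_identity b0
      using sj by (simp add: sum_kron)
    finally show "B $$ (s, j) = (C2_mat r * E) $$ (s, j)"
      using sj by (simp add: B_def)
  qed (use C2_mat_carrier[of r] B E in auto)
  have FB: "F * B = 1\<^sub>m (r - 1)"
  proof (rule eq_matI)
    fix i j assume "i < dim_row (1\<^sub>m (r - 1))" "j < dim_col (1\<^sub>m (r - 1))"
    then have ij: "i < r - 1" "j < r - 1" by auto
    have "(F * B) $$ (i, j) = (\<Sum>s<r. kron i s * b j s)"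
      unfolding mult_entry[OF F B ij] using ij by (simp add: F_def B_def)
    also have "\<dots> = b j i" using ij by (simp add: sum_kron)
    finally show "(F * B) $$ (i, j) = 1\<^sub>m (r - 1) $$ (i, j)"
      using ij by (auto simp: b_def kron_def)
  qed (use F B in auto)
  show ?thesis
    by (rule rank_eq_of_factorization[OF C2_mat_carrier B D E F BD CE FB])
qed

theorem theorem3p11:
  fixes r :: nat
  assumes "r \<ge> 1"
  shows "((\<exists>C\<^sub>1. extreme_point_mat C\<^sub>1 (Cor r ((r choose 2) + 1)) \<and> vec_space.rank r C\<^sub>1 = r) \<and>
          (extreme_point_mat (C1_mat r) (Cor r ((r choose 2) + 1)) \<and> vec_space.rank r (C1_mat r) = r)) \<and>
         ((\<exists>C\<^sub>2. extreme_point_mat C\<^sub>2 (Cor r (r choose 2)) \<and> vec_space.rank r C\<^sub>2 = r - 1) \<and>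
          (extreme_point_mat (C2_mat r) (Cor r (r choose 2)) \<and> vec_space.rank r (C2_mat r) = r - 1))"
proof -
  have "extreme_point_mat (C2_mat r) (Cor r (r choose 2))"
  proof (cases "r = 1")
    case True
    then show ?thesis
      using extreme_point_mat_no_columns[of "C2_mat r" r] C2_mat_carrier[of r] by (simp add: numeral_2_eq_2)
  next
    case False
    then show ?thesis using extreme_C2_mat[of r] assms by simp
  qed
  then show ?thesis
    using extreme_C1_mat[OF assms] rank_C1_mat[OF assms] rank_C2_mat[OF assms] by blast
qed

end
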